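(* Let $\mathcal{H}$ be a separable, infinite-dimensional, complex Hilbert space and let $C$ be a conjugation on $\mathcal{H}$. Then any Lie subalgebra of $\mathcal{B}(\mathcal{H})$ is Lie isomorphic to a Lie subalgebra of $\mathcal{O}_C$.
   Context: $\mathcal{B}(\mathcal{H})$ is the algebra of all bounded linear operators on $\mathcal{H}$, regarded as a Lie algebra under $[X,Y]=XY-YX$. A conjugation on $\mathcal{H}$ is a conjugate-linear map $C:\mathcal{H}\to\mathcal{H}$ with $C^{-1}=C$ and $\langle Cx,Cy\rangle=\langle y,x\rangle$ for all $x,y\in\mathcal{H}$. $\mathcal{O}_C=\{X\in\mathcal{B}(\mathcal{H}): CXC=-X^*\}$, a Lie algebra under the same bracket. Lie subalgebras are linear subspaces closed under the bracket (not assumed topologically closed). *)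

theory Defs
  imports "HOL-Analysis.Analysis"
begin

section \<open>Complex Hilbert spaces\<close>

text \<open>
  The inner product is linear in its first argument. The last axiom ties it to the norm of the
  Banach space; since its left-hand side is a nonnegative real that vanishes only at \<open>0\<close>, it also
  contains the positive definiteness of the inner product.
\<close>

class complex_hilbert = banach +
  fixes scaleC :: "complex \<Rightarrow> 'a \<Rightarrow> 'a" (infixr "*\<^sub>C" 75)
    and cinner :: "'a \<Rightarrow> 'a \<Rightarrow> complex"
  assumes scaleC_add_right: "a *\<^sub>C (x + y) = a *\<^sub>C x + a *\<^sub>C y"
    and scaleC_add_left: "(a + b) *\<^sub>C x = a *\<^sub>C x + b *\<^sub>C x"
    and scaleC_scaleC: "a *\<^sub>C b *\<^sub>C x = (a * b) *\<^sub>C x"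
    and scaleR_scaleC: "r *\<^sub>R x = complex_of_real r *\<^sub>C x"
    and cinner_add_left: "cinner (x + y) z = cinner x z + cinner y z"
    and cinner_scaleC_left: "cinner (a *\<^sub>C x) y = a * cinner x y"
    and cinner_commute: "cinner x y = cnj (cinner y x)"
    and norm_sq_eq_cinner: "complex_of_real ((norm x)\<^sup>2) = cinner x x"

lemma scaleC_one: "1 *\<^sub>C x = (x :: 'a :: complex_hilbert)"
  by (metis of_real_1 scaleR_one scaleR_scaleC)

lemma vector_space_scaleC: "vector_space (scaleC :: complex \<Rightarrow> 'a :: complex_hilbert \<Rightarrow> 'a)"
  by unfold_locales (simp_all add: scaleC_add_right scaleC_add_left scaleC_scaleC scaleC_one)

definition infinite_dimensional :: "'a :: complex_hilbert itself \<Rightarrow> bool" where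
  "infinite_dimensional _ \<longleftrightarrow>
     \<not> (\<exists>B :: 'a set. finite B \<and> module.span scaleC B = UNIV)"


section \<open>Bounded operators and adjoints\<close>

definition bounded_operators :: "('a :: complex_hilbert \<Rightarrow> 'a) set" where
  "bounded_operators = {X. bounded_linear X \<and> (\<forall>c x. X (c *\<^sub>C x) = c *\<^sub>C X x)}"

definition cadjoint :: "('a :: complex_hilbert \<Rightarrow> 'a) \<Rightarrow> 'a \<Rightarrow> 'a" where
  "cadjoint X = (THE Y. \<forall>x y. cinner (X x) y = cinner x (Y y))"

text \<open>
  The description defining \<open>cadjoint\<close> is proper for every bounded operator: uniqueness is
  immediate, existence is the Riesz representation theorem, which is proved below by minimising
  \<open>\<parallel>x\<parallel>\<^sup>2 - 2 Re (f x)\<close>.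
\<close>

lemma cinner_add_right: "cinner x (y + z) = cinner x y + cinner x (z :: 'a :: complex_hilbert)"
  by (metis cinner_add_left cinner_commute complex_cnj_add)

lemma cinner_scaleC_right: "cinner x (a *\<^sub>C y) = cnj a * cinner x (y :: 'a :: complex_hilbert)"
  by (metis cinner_commute cinner_scaleC_left complex_cnj_mult)

lemma cinner_scaleR_left: "cinner (r *\<^sub>R x) y = of_real r * cinner x (y :: 'a :: complex_hilbert)"
  by (simp add: scaleR_scaleC cinner_scaleC_left)

lemma cinner_scaleR_right: "cinner x (r *\<^sub>R y) = of_real r * cinner x (y :: 'a :: complex_hilbert)"
  by (simp add: scaleR_scaleC cinner_scaleC_right)

lemma cinner_minus_left: "cinner (- x) y = - cinner x (y :: 'a :: complex_hilbert)"
  using cinner_scaleR_left[of "-1" x y] by simp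

lemma cinner_minus_right: "cinner x (- y) = - cinner x (y :: 'a :: complex_hilbert)"
  using cinner_scaleR_right[of x "-1" y] by simp

lemma cinner_diff_right: "cinner x (y - z) = cinner x y - cinner x (z :: 'a :: complex_hilbert)"
  using cinner_add_right[of x y "- z"] by (simp add: cinner_minus_right)

lemma Re_cinner_commute: "Re (cinner x y) = Re (cinner y (x :: 'a :: complex_hilbert))"
  by (metis cinner_commute complex_cnj(1) complex.sel(1) complex_surj)

lemma norm_sq_add_scaleR:
  "(norm (x + t *\<^sub>R y))\<^sup>2
     = (norm x)\<^sup>2 + 2 * t * Re (cinner x y) + t\<^sup>2 * (norm (y :: 'a :: complex_hilbert))\<^sup>2"
proof -
  have n: "(norm z)\<^sup>2 = Re (cinner z z)" for z :: 'a
    by (metis Re_complex_of_real norm_sq_eq_cinner)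
  show ?thesis
    unfolding n using Re_cinner_commute[of x y]
    by (simp add: cinner_add_left cinner_add_right cinner_scaleR_left cinner_scaleR_right
        algebra_simps power2_eq_square)
qed

lemma quadratic_nonneg_linear_zero:
  fixes a b :: real
  assumes "\<And>t. 0 \<le> 2 * t * a + t\<^sup>2 * b"
  shows "a = 0"
proof (rule ccontr)
  assume a: "a \<noteq> 0"
  define d where "d = \<bar>b\<bar> + 1"
  have d: "d > 0" "b < 2 * d" by (auto simp: d_def)
  have "0 \<le> 2 * (- a / d) * a + (- a / d)\<^sup>2 * b" by (rule assms)
  also have "\<dots> = (a\<^sup>2 / d\<^sup>2) * (b - 2 * d)"
    using d by (simp add: field_simps power2_eq_square)
  also have "\<dots> < 0" using a d by (intro mult_pos_neg) auto
  finally show False by simp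
qed

lemma abs_Re_cinner_le: "\<bar>Re (cinner x y)\<bar> \<le> norm x * norm (y :: 'a :: complex_hilbert)"
proof (cases "y = 0")
  case True
  then show ?thesis using cinner_scaleR_right[of x 0 0] by simp
next
  case False
  define t where "t = - Re (cinner x y) / (norm y)\<^sup>2"
  have "0 \<le> (norm (x + t *\<^sub>R y))\<^sup>2" by simp
  also have "\<dots> = (norm x)\<^sup>2 - (Re (cinner x y))\<^sup>2 / (norm y)\<^sup>2"
    unfolding norm_sq_add_scaleR t_def using False by (simp add: field_simps power2_eq_square)
  finally have "(Re (cinner x y))\<^sup>2 \<le> (norm x * norm y)\<^sup>2"
    using False by (simp add: field_simps power_mult_distrib)
  then show ?thesis by (simp add: abs_le_square_iff[symmetric])
qed

lemma riesz_real:
  fixes g :: "'a :: complex_hilbert \<Rightarrow> real"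
  assumes g: "bounded_linear g"
  obtains z where "\<And>h. g h = Re (cinner h z)"
proof -
  interpret g: bounded_linear g by (rule g)
  obtain K where K: "K \<ge> 0" "\<And>x. \<bar>g x\<bar> \<le> norm x * K"
    using g.nonneg_bounded by auto
  define q where "q x = (norm x)\<^sup>2 - 2 * g x" for x
  have q_low: "q x \<ge> - K\<^sup>2" for x
  proof -
    have "2 * g x \<le> 2 * (norm x * K)" using K(2)[of x] by linarith
    moreover have "0 \<le> (norm x - K)\<^sup>2" by simp
    ultimately show ?thesis by (simp add: q_def power2_eq_square algebra_simps)
  qed
  have bdd: "bdd_below (range q)" using q_low by (auto intro!: bdd_belowI)
  define m where "m = Inf (range q)"
  have m_le: "m \<le> q x" for x unfolding m_def using bdd by (auto intro: cInf_lower)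
  have "\<exists>x. q x < m + 1 / real (Suc n)" for n
    using cInf_lessD[of "range q" "m + 1 / real (Suc n)"] by (auto simp: m_def)
  then obtain X where X: "\<And>n. q (X n) < m + 1 / real (Suc n)" by metis
  have par: "(norm (x - y))\<^sup>2 \<le> 2 * (q x - m) + 2 * (q y - m)" for x y
  proof -
    have e1: "(norm (x - y))\<^sup>2 = (norm x)\<^sup>2 - 2 * Re (cinner x y) + (norm y)\<^sup>2"
      using norm_sq_add_scaleR[of x "-1" y] by simp
    have e2: "(norm (x + y))\<^sup>2 = (norm x)\<^sup>2 + 2 * Re (cinner x y) + (norm y)\<^sup>2"
      using norm_sq_add_scaleR[of x 1 y] by simp
    have "q ((1/2) *\<^sub>R (x + y)) = (norm (x + y))\<^sup>2 / 4 - (g x + g y)"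
      by (simp add: q_def g.scaleR g.add power_divide add_divide_distrib)
    then show ?thesis
      using m_le[of "(1/2) *\<^sub>R (x + y)"] e1 e2 unfolding q_def by argo
  qed
  have "Cauchy X"
  proof (rule metric_CauchyI)
    fix e :: real assume e: "e > 0"
    obtain N where N: "1 / real (Suc N) < e\<^sup>2 / 4"
      using e nat_approx_posE[of "e\<^sup>2 / 4"] by auto
    have "dist (X i) (X j) < e" if "i \<ge> N" "j \<ge> N" for i j
    proof -
      have "1 / real (Suc i) \<le> 1 / real (Suc N)" "1 / real (Suc j) \<le> 1 / real (Suc N)"
        using that by (auto intro!: divide_left_mono)
      then have "q (X i) - m < e\<^sup>2 / 4" "q (X j) - m < e\<^sup>2 / 4"
        using X[of i] X[of j] N by (smt (verit))+
      then have "(norm (X i - X j))\<^sup>2 < e\<^sup>2"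
        using par[of "X i" "X j"] by argo
      then show ?thesis using e by (simp add: dist_norm power_less_imp_less_base)
    qed
    then show "\<exists>M. \<forall>i\<ge>M. \<forall>j\<ge>M. dist (X i) (X j) < e" by blast
  qed
  then obtain z where z: "X \<longlonglongrightarrow> z" using Cauchy_convergent_iff convergent_def by blast
  have "(\<lambda>n. q (X n)) \<longlonglongrightarrow> q z"
    unfolding q_def by (intro tendsto_intros g.tendsto z)
  moreover have "(\<lambda>n. m + 1 / real (Suc n)) \<longlonglongrightarrow> m + 0"
    by (intro tendsto_intros LIMSEQ_Suc[OF lim_1_over_n])
  ultimately have "q z \<le> m + 0"
    by (rule LIMSEQ_le) (use X less_imp_le in blast)
  then have qz: "q z \<le> m" by simp
  have "g h = Re (cinner h z)" for h
  proof -
    have "0 \<le> 2 * t * (Re (cinner z h) - g h) + t\<^sup>2 * (norm h)\<^sup>2" for t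
      using m_le[of "z + t *\<^sub>R h"] qz unfolding q_def norm_sq_add_scaleR g.add g.scaleR
      by (simp add: algebra_simps)
    then have "Re (cinner z h) - g h = 0" by (rule quadratic_nonneg_linear_zero)
    then show ?thesis by (simp add: Re_cinner_commute)
  qed
  then show ?thesis by (rule that)
qed

lemma cinner_eq_rightD:
  assumes "\<And>x. cinner x y = cinner x (z :: 'a :: complex_hilbert)"
  shows "y = z"
proof -
  have "complex_of_real ((norm (y - z))\<^sup>2) = 0"
    using assms by (simp add: norm_sq_eq_cinner cinner_diff_right del: of_real_power)
  then show ?thesis by simp
qed

lemma cadjoint_eqI:
  assumes "\<And>x y. cinner (X x) y = cinner x (Y y)"
  shows "cadjoint X = Y"
  unfolding cadjoint_def
proof (rule the_equality)
  fix Y' assume "\<forall>x y. cinner (X x) y = cinner x (Y' y)"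
  then show "Y' = Y" using assms by (metis cinner_eq_rightD ext)
qed (use assms in blast)

lemma cadjoint:
  fixes X :: "'a :: complex_hilbert \<Rightarrow> 'a"
  assumes X: "X \<in> bounded_operators"
  shows "cinner (X x) y = cinner x (cadjoint X y)"
proof -
  interpret X: bounded_linear X using X by (simp add: bounded_operators_def)
  have XC: "X (c *\<^sub>C x) = c *\<^sub>C X x" for c x using X by (simp add: bounded_operators_def)
  have "\<exists>z. \<forall>x. cinner (X x) y = cinner x z" for y
  proof -
    obtain K where K: "\<And>x. norm (X x) \<le> norm x * K" using X.nonneg_bounded by blast
    have "bounded_linear (\<lambda>x. Re (cinner (X x) y))"
    proof (rule bounded_linear_intro[where K = "K * norm y"])
      fix x
      have "\<bar>Re (cinner (X x) y)\<bar> \<le> norm (X x) * norm y" by (rule abs_Re_cinner_le)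
      also have "\<dots> \<le> (norm x * K) * norm y" by (intro mult_right_mono K) simp
      finally show "norm (Re (cinner (X x) y)) \<le> norm x * (K * norm y)" by (simp add: mult.assoc)
    qed (simp_all add: X.add X.scaleR cinner_add_left cinner_scaleR_left)
    then obtain z where z: "\<And>x. Re (cinner (X x) y) = Re (cinner x z)" by (rule riesz_real) blast
    have "cinner (X x) y = cinner x z" for x
      using z[of x] z[of "\<i> *\<^sub>C x"] by (intro complex_eqI) (simp_all add: XC cinner_scaleC_left)
    then show ?thesis by blast
  qed
  then obtain Y where Y: "\<And>x y. cinner (X x) y = cinner x (Y y)" by metis
  then show ?thesis using cadjoint_eqI[of X Y] by simp
qed


section \<open>Conjugations and the associated operator Lie algebras\<close>

definition conjugation :: "('a :: complex_hilbert \<Rightarrow> 'a) \<Rightarrow> bool" where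
  "conjugation C \<longleftrightarrow>
     (\<forall>x y. C (x + y) = C x + C y) \<and> (\<forall>c x. C (c *\<^sub>C x) = cnj c *\<^sub>C C x) \<and>
     (\<forall>x. C (C x) = x) \<and> (\<forall>x y. cinner (C x) (C y) = cinner y x)"

definition skew_operators :: "('a :: complex_hilbert \<Rightarrow> 'a) \<Rightarrow> ('a \<Rightarrow> 'a) set" where
  "skew_operators C = {X \<in> bounded_operators. C \<circ> X \<circ> C = (\<lambda>x. - cadjoint X x)}"

definition commutator :: "('a :: complex_hilbert \<Rightarrow> 'a) \<Rightarrow> ('a \<Rightarrow> 'a) \<Rightarrow> 'a \<Rightarrow> 'a" where
  "commutator X Y = (\<lambda>x. X (Y x) - Y (X x))"

definition lie_subalgebra :: "('a :: complex_hilbert \<Rightarrow> 'a) set \<Rightarrow> ('a \<Rightarrow> 'a) set \<Rightarrow> bool" where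
  "lie_subalgebra L G \<longleftrightarrow>
     L \<subseteq> G \<and> (\<lambda>x. 0) \<in> L \<and>
     (\<forall>X\<in>L. \<forall>Y\<in>L. (\<lambda>x. X x + Y x) \<in> L) \<and>
     (\<forall>c. \<forall>X\<in>L. (\<lambda>x. c *\<^sub>C X x) \<in> L) \<and>
     (\<forall>X\<in>L. \<forall>Y\<in>L. commutator X Y \<in> L)"

definition lie_isomorphic :: "('a :: complex_hilbert \<Rightarrow> 'a) set \<Rightarrow> ('a \<Rightarrow> 'a) set \<Rightarrow> bool" where
  "lie_isomorphic L M \<longleftrightarrow>
     (\<exists>\<phi>. bij_betw \<phi> L M \<and>
       (\<forall>X\<in>L. \<forall>Y\<in>L. \<phi> (\<lambda>x. X x + Y x) = (\<lambda>x. \<phi> X x + \<phi> Y x)) \<and>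
       (\<forall>c. \<forall>X\<in>L. \<phi> (\<lambda>x. c *\<^sub>C X x) = (\<lambda>x. c *\<^sub>C \<phi> X x)) \<and>
       (\<forall>X\<in>L. \<forall>Y\<in>L. \<phi> (commutator X Y) = commutator (\<phi> X) (\<phi> Y)))"

end

theory Submission
  imports Defs
begin

text \<open>
  Let \<open>U\<close> be an isometry with \<open>U\<^sup>* C U = 0\<close>, i.e. the ranges of \<open>U\<close> and \<open>C U C\<close> are orthogonal copies of
  the whole space. Then \<open>X \<mapsto> A - C A\<^sup>* C\<close> with \<open>A = U X U\<^sup>*\<close> is an injective Lie homomorphism
  into the skew operators: \<open>X \<mapsto> A\<close> is multiplicative, \<open>X \<mapsto> - C A\<^sup>* C\<close> respects brackets, and the two
  parts annihilate each other. To obtain \<open>U\<close>, run the Gram-Schmidt process inside the real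
  subspace \<open>{x. C x = x}\<close>, giving an orthonormal basis \<open>e\<close> with \<open>C (e n) = e n\<close>, and let
  \<open>U (e n) = (e (2 n) + \<i> e (2 n + 1)) / sqrt 2\<close>.
\<close>

section \<open>Inner product and scalar multiplication as bounded bilinear maps\<close>

lemma norm_sq_eq_Re_cinner: "(norm x)\<^sup>2 = Re (cinner x (x :: 'a :: complex_hilbert))"
  by (metis Re_complex_of_real norm_sq_eq_cinner)

lemma norm_eq_if_cinner_eq:
  "cinner x x = cinner y y \<Longrightarrow> norm x = norm (y :: 'a :: complex_hilbert)"
  by (metis norm_sq_eq_Re_cinner norm_ge_zero power2_eq_imp_eq)

lemma norm_scaleC: "norm (c *\<^sub>C x) = cmod c * norm (x :: 'a :: complex_hilbert)"
proof -
  have "(norm (c *\<^sub>C x))\<^sup>2 = Re ((c * cnj c) * cinner x x)"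
    by (simp add: norm_sq_eq_Re_cinner cinner_scaleC_left cinner_scaleC_right mult_ac)
  also have "\<dots> = (cmod c * norm x)\<^sup>2"
    unfolding complex_norm_square[symmetric] norm_sq_eq_cinner[symmetric]
    by (simp add: power_mult_distrib del: of_real_power)
  finally show ?thesis by simp
qed

lemma bounded_bilinear_scaleC: "bounded_bilinear (scaleC :: complex \<Rightarrow> 'a :: complex_hilbert \<Rightarrow> 'a)"
proof
  show "\<exists>K. \<forall>a b. norm (a *\<^sub>C (b :: 'a)) \<le> norm a * norm b * K"
    by (rule exI[of _ 1]) (simp add: norm_scaleC)
qed (simp_all add: scaleC_add_left scaleC_add_right scaleR_scaleC scaleC_scaleC
    scaleR_conv_of_real mult.commute)

text \<open>The imaginary part of \<open>cinner a b\<close> is the real part of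
  \<open>cinner a (\<i> *\<^sub>C b)\<close>, so the real Cauchy-Schwarz bound applies to both
  parts. Adding the two bounds gives the constant 2, which is enough for continuity.\<close>

lemma bounded_bilinear_cinner: "bounded_bilinear (cinner :: 'a :: complex_hilbert \<Rightarrow> 'a \<Rightarrow> complex)"
proof
  show "\<exists>K. \<forall>a b. norm (cinner a (b :: 'a)) \<le> norm a * norm b * K"
  proof (intro exI allI)
    fix a b :: 'a
    have "norm (cinner a b) \<le> \<bar>Re (cinner a b)\<bar> + \<bar>Im (cinner a b)\<bar>" by (rule cmod_le)
    moreover have "Im (cinner a b) = Re (cinner a (\<i> *\<^sub>C b))"
      by (simp add: cinner_scaleC_right)
    ultimately show "norm (cinner a b) \<le> norm a * norm b * 2"
      using abs_Re_cinner_le[of a b] abs_Re_cinner_le[of a "\<i> *\<^sub>C b"] by (simp add: norm_scaleC)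
  qed
qed (simp_all add: cinner_add_left cinner_add_right cinner_scaleR_left cinner_scaleR_right
    scaleR_conv_of_real)

interpretation scaleC: bounded_bilinear "scaleC :: complex \<Rightarrow> 'a :: complex_hilbert \<Rightarrow> 'a"
  by (rule bounded_bilinear_scaleC)

interpretation cinner: bounded_bilinear "cinner :: 'a :: complex_hilbert \<Rightarrow> 'a \<Rightarrow> complex"
  by (rule bounded_bilinear_cinner)


section \<open>Bounded operators\<close>

lemma bounded_operatorsD:
  assumes "X \<in> bounded_operators"
  shows "bounded_linear X" "X (c *\<^sub>C x) = c *\<^sub>C X x"
  using assms by (auto simp: bounded_operators_def)

lemma bounded_operators_compose:
  assumes "X \<in> bounded_operators" "Y \<in> bounded_operators"
  shows "(\<lambda>x. X (Y x)) \<in> bounded_operators"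
  using assms by (auto simp: bounded_operators_def intro: bounded_linear_compose)

lemma bounded_operators_diff:
  assumes "X \<in> bounded_operators" "Y \<in> bounded_operators"
  shows "(\<lambda>x. X x - Y x) \<in> bounded_operators"
  using assms by (auto simp: bounded_operators_def scaleC.diff_right intro: bounded_linear_sub)

text \<open>Linearity holds because a vector is determined by its inner products. For the bound, put
  \<open>w = cadjoint X y\<close>: then \<open>norm w\<close> squared equals
  \<open>Re (cinner (X w) y)\<close>, at most \<open>K * norm w * norm y\<close>, and
  \<open>norm w\<close> cancels.\<close>

lemma cadjoint_bounded_operators:
  fixes X :: "'a :: complex_hilbert \<Rightarrow> 'a"
  assumes X: "X \<in> bounded_operators"
  shows "cadjoint X \<in> bounded_operators"
proof -
  interpret X: bounded_linear X by (rule bounded_operatorsD(1)[OF X])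
  note adj = cadjoint[OF X, symmetric]
  have add: "cadjoint X (y + z) = cadjoint X y + cadjoint X z" for y z
    by (rule cinner_eq_rightD) (simp add: adj cinner_add_right)
  have scale: "cadjoint X (c *\<^sub>C y) = c *\<^sub>C cadjoint X y" for c y
    by (rule cinner_eq_rightD) (simp add: adj cinner_scaleC_right)
  obtain K where K: "\<And>x. norm (X x) \<le> norm x * K" using X.nonneg_bounded by blast
  have "norm (cadjoint X y) \<le> norm y * K" for y
  proof -
    let ?w = "cadjoint X y"
    have "norm ?w * norm ?w = Re (cinner (X ?w) y)"
      by (simp add: adj[symmetric] norm_sq_eq_Re_cinner[symmetric] power2_eq_square)
    also have "\<dots> \<le> norm (X ?w) * norm y" using abs_Re_cinner_le[of "X ?w" y] by simp
    also have "\<dots> \<le> norm ?w * (norm y * K)"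
      using mult_right_mono[OF K[of ?w], of "norm y"] by (simp add: mult_ac)
    finally show ?thesis
      by (cases "?w = 0") (use K[of y] in \<open>auto intro: order_trans[OF norm_ge_zero]\<close>)
  qed
  then have "bounded_linear (cadjoint X)"
    by (intro bounded_linear_intro[where K = K]) (simp_all add: add scale scaleR_scaleC)
  with scale show ?thesis by (simp add: bounded_operators_def)
qed

section \<open>Algebraic rules for adjoints\<close>

lemma cadjoint_left:
  assumes "X \<in> bounded_operators"
  shows "cinner (cadjoint X x) y = cinner x (X y)"
  by (metis cadjoint[OF assms] cinner_commute)

lemma cadjoint_add:
  assumes "X \<in> bounded_operators" "Y \<in> bounded_operators"
  shows "cadjoint (\<lambda>x. X x + Y x) = (\<lambda>x. cadjoint X x + cadjoint Y x)"
  by (rule cadjoint_eqI) (simp add: cadjoint assms cinner_add_left cinner_add_right)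

lemma cadjoint_diff:
  assumes "X \<in> bounded_operators" "Y \<in> bounded_operators"
  shows "cadjoint (\<lambda>x. X x - Y x) = (\<lambda>x. cadjoint X x - cadjoint Y x)"
  by (rule cadjoint_eqI) (simp add: cadjoint assms cinner.diff_left cinner.diff_right)

lemma cadjoint_scaleC:
  assumes "X \<in> bounded_operators"
  shows "cadjoint (\<lambda>x. c *\<^sub>C X x) = (\<lambda>x. cnj c *\<^sub>C cadjoint X x)"
  by (rule cadjoint_eqI) (simp add: cadjoint assms cinner_scaleC_left cinner_scaleC_right)

lemma cadjoint_compose:
  assumes "X \<in> bounded_operators" "Y \<in> bounded_operators"
  shows "cadjoint (\<lambda>x. X (Y x)) = (\<lambda>x. cadjoint Y (cadjoint X x))"
  by (rule cadjoint_eqI) (simp add: cadjoint assms)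

lemma cadjoint_cadjoint:
  assumes "X \<in> bounded_operators"
  shows "cadjoint (cadjoint X) = X"
  by (rule cadjoint_eqI) (simp add: cadjoint_left assms)


section \<open>Conjugations\<close>

locale conjugation_on =
  fixes C :: "'a :: complex_hilbert \<Rightarrow> 'a"
  assumes conjugation: "conjugation C"
begin

lemma C_scaleC: "C (c *\<^sub>C x) = cnj c *\<^sub>C C x"
  and C_C: "C (C x) = x"
  and cinner_C_C: "cinner (C x) (C y) = cinner y x"
  using conjugation by (auto simp: conjugation_def)

lemma norm_C: "norm (C x) = norm x"
  by (rule norm_eq_if_cinner_eq) (rule cinner_C_C)

sublocale C: bounded_linear C
  by (rule bounded_linear_intro[where K = 1])
    (use conjugation in \<open>simp_all add: conjugation_def scaleR_scaleC norm_C\<close>)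

lemma conjugate_bounded_operators:
  assumes "X \<in> bounded_operators"
  shows "(\<lambda>x. C (X (C x))) \<in> bounded_operators"
  using assms by (auto simp: bounded_operators_def C_scaleC
      intro!: bounded_linear_compose[OF C.bounded_linear_axioms]
        bounded_linear_compose[OF _ C.bounded_linear_axioms])

text \<open>\<open>C\<close> moves across the inner product at the price of swapping the arguments.
  Two such swaps, with \<open>X\<close> replaced by its adjoint in between, restore the
  order.\<close>

lemma cadjoint_conjugate:
  assumes "X \<in> bounded_operators"
  shows "cadjoint (\<lambda>x. C (X (C x))) = (\<lambda>x. C (cadjoint X (C x)))"
  by (rule cadjoint_eqI) (metis C_C cadjoint_left[OF assms] cinner_C_C)

text \<open>The analogue of splitting a complex number into real and imaginary part:
  \<open>a = (x + C x)/2\<close> and \<open>b = (x - C x)/(2i)\<close>. It reduces linear questions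
  to vectors fixed by \<open>C\<close>.\<close>

lemma real_parts:
  obtains a b where "C a = a" "C b = b" "x = a + \<i> *\<^sub>C b"
proof
  let ?a = "(1/2) *\<^sub>C (x + C x)" and ?b = "(- \<i>/2) *\<^sub>C (x - C x)"
  show "C ?a = ?a" by (simp add: C_scaleC C.add C_C add.commute)
  show "C ?b = ?b" by (simp add: C_scaleC C.diff C_C scaleC.diff_right scaleC.minus_left)
  have "x = (1/2 + 1/2) *\<^sub>C x" by (simp add: scaleC_one)
  also have "\<dots> = ?a + \<i> *\<^sub>C ?b"
    by (simp only: scaleC_add_left scaleC_scaleC scaleC_add_right scaleC.diff_right) simp
  finally show "x = ?a + \<i> *\<^sub>C ?b" .
qed

end


section \<open>Orthonormal families\<close>

definition orthonormal_on :: "'i set \<Rightarrow> ('i \<Rightarrow> 'a :: complex_hilbert) \<Rightarrow> bool" where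
  "orthonormal_on K f \<longleftrightarrow> (\<forall>i\<in>K. \<forall>j\<in>K. cinner (f i) (f j) = of_bool (i = j))"

text \<open>A truncated Fourier expansion in \<open>e\<close> with the basis vectors replaced by
  those of \<open>f\<close>. For \<open>e = f\<close> orthonormal and \<open>K\<close> finite it is
  the orthogonal projection onto the span of \<open>e\<close> over \<open>K\<close>.\<close>

definition transfer_sum ::
    "('i \<Rightarrow> 'a :: complex_hilbert) \<Rightarrow> ('i \<Rightarrow> 'a) \<Rightarrow> 'i set \<Rightarrow> 'a \<Rightarrow> 'a" where
  "transfer_sum e f K x = (\<Sum>k\<in>K. cinner x (e k) *\<^sub>C f k)"

lemma transfer_sum_add: "transfer_sum e f K (x + y) = transfer_sum e f K x + transfer_sum e f K y"
  by (simp add: transfer_sum_def cinner_add_left scaleC_add_left sum.distrib)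

lemma transfer_sum_diff: "transfer_sum e f K (x - y) = transfer_sum e f K x - transfer_sum e f K y"
  by (simp add: transfer_sum_def cinner.diff_left scaleC.diff_left sum_subtractf)

lemma transfer_sum_scaleC: "transfer_sum e f K (c *\<^sub>C x) = c *\<^sub>C transfer_sum e f K x"
  by (simp add: transfer_sum_def cinner_scaleC_left scaleC.sum_right scaleC_scaleC)

text \<open>A finite Parseval identity. The right-hand side does not mention \<open>f\<close>, so
  transferring to different orthonormal families yields equal inner products.\<close>

lemma cinner_transfer_sum:
  assumes "finite K" "orthonormal_on K f"
  shows "cinner (transfer_sum e f K x) (transfer_sum e f K y)
    = (\<Sum>k\<in>K. cinner x (e k) * cnj (cinner y (e k)))"
proof -
  have "cinner (transfer_sum e f K x) (transfer_sum e f K y)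
      = (\<Sum>i\<in>K. \<Sum>j\<in>K. cinner x (e i) * cnj (cinner y (e j)) * cinner (f i) (f j))"
    unfolding transfer_sum_def cinner.sum_left
    by (simp add: cinner.sum_right cinner_scaleC_left cinner_scaleC_right sum_distrib_left mult_ac)
  also have "\<dots> = (\<Sum>i\<in>K. \<Sum>j\<in>K. if i = j then cinner x (e i) * cnj (cinner y (e j)) else 0)"
    by (intro sum.cong) (use assms in \<open>auto simp: orthonormal_on_def\<close>)
  finally show ?thesis using assms(1) by simp
qed

lemma cinner_residual_basis:
  assumes "finite K" "orthonormal_on K e" "j \<in> K"
  shows "cinner (x - transfer_sum e e K x) (e j) = 0"
proof -
  have "cinner (transfer_sum e e K x) (e j) = (\<Sum>i\<in>K. if i = j then cinner x (e i) else 0)"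
    unfolding transfer_sum_def cinner.sum_left cinner_scaleC_left
    by (intro sum.cong) (use assms in \<open>auto simp: orthonormal_on_def\<close>)
  then show ?thesis using assms by (simp add: cinner.diff_left)
qed

text \<open>Pythagoras: the residual is orthogonal to the projection.\<close>

lemma norm_residual_le:
  assumes "finite K" "orthonormal_on K e"
  shows "norm (x - transfer_sum e e K x) \<le> norm x"
proof -
  let ?p = "transfer_sum e e K x"
  have "cinner (x - ?p) ?p = 0"
    by (subst (2) transfer_sum_def)
      (simp add: cinner.sum_right cinner_scaleC_right cinner_residual_basis assms)
  then have "(norm x)\<^sup>2 = (norm (x - ?p))\<^sup>2 + (norm ?p)\<^sup>2"
    using norm_sq_add_scaleR[of "x - ?p" 1 ?p] by simp
  then have "(norm (x - ?p))\<^sup>2 \<le> (norm x)\<^sup>2" by simp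
  then show ?thesis by (rule power2_le_imp_le) simp
qed

text \<open>Differences of partial sums are transfers over index intervals, so by Parseval the sums
  along \<open>f\<close> have the same mutual distances as those along \<open>e\<close>. The latter
  converge to \<open>x\<close>; hence the former are Cauchy and their limit defines
  \<open>U x\<close>.\<close>

lemma transfer_isometry:
  fixes e f :: "nat \<Rightarrow> 'a :: complex_hilbert"
  assumes e: "orthonormal_on UNIV e" and f: "orthonormal_on UNIV f"
    and complete: "\<And>x. (\<lambda>n. transfer_sum e e {..<n} x) \<longlonglongrightarrow> x"
  obtains U where "U \<in> bounded_operators" "\<And>x y. cinner (U x) (U y) = cinner x y"
    "\<And>x. (\<lambda>n. transfer_sum e f {..<n} x) \<longlonglongrightarrow> U x"
proof -
  have on: "orthonormal_on K e" "orthonormal_on K f" for K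
    using e f by (auto simp: orthonormal_on_def)
  have diff: "transfer_sum e g {..<n} x - transfer_sum e g {..<m} x = transfer_sum e g {m..<n} x"
    if "m \<le> n" for g m n x
    using that sum_diff_nat_ivl[of 0 m n "\<lambda>k. cinner x (e k) *\<^sub>C g k"]
    by (simp add: transfer_sum_def lessThan_atLeast0)
  have "dist (transfer_sum e f {..<m} x) (transfer_sum e f {..<n} x)
      = dist (transfer_sum e e {..<m} x) (transfer_sum e e {..<n} x)" for m n x
  proof (induction m n rule: linorder_wlog)
    case (le m n)
    have "norm (transfer_sum e f {m..<n} x) = norm (transfer_sum e e {m..<n} x)"
      by (rule norm_eq_if_cinner_eq) (simp add: cinner_transfer_sum on)
    then show ?case
      by (simp add: dist_norm norm_minus_commute[of "transfer_sum e _ {..<m} x"] diff le)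
  qed (simp add: dist_commute)
  moreover have "Cauchy (\<lambda>n. transfer_sum e e {..<n} x)" for x
    using complete LIMSEQ_imp_Cauchy by blast
  ultimately have "convergent (\<lambda>n. transfer_sum e f {..<n} x)" for x
    unfolding Cauchy_convergent_iff[symmetric] Cauchy_def by simp
  then obtain U where U: "\<And>x. (\<lambda>n. transfer_sum e f {..<n} x) \<longlonglongrightarrow> U x"
    unfolding convergent_def by metis
  have add: "U (x + y) = U x + U y" for x y
    using tendsto_add[OF U U, of x y] U[of "x + y"]
    unfolding transfer_sum_add by (rule LIMSEQ_unique[rotated])
  have scale: "U (c *\<^sub>C x) = c *\<^sub>C U x" for c x
    using scaleC.tendsto[OF tendsto_const U, of c x] U[of "c *\<^sub>C x"]
    unfolding transfer_sum_scaleC by (rule LIMSEQ_unique[rotated])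
  \<comment> \<open>By Parseval the two sequences of inner products agree term by term, so their
    limits agree.\<close>
  have iso: "cinner (U x) (U y) = cinner x y" for x y
    using cinner.tendsto[OF U U, of x y] cinner.tendsto[OF complete complete, of x y]
    by (simp add: cinner_transfer_sum on LIMSEQ_unique)
  have "norm (U x) = norm x" for x
    by (rule norm_eq_if_cinner_eq) (rule iso)
  then have "bounded_linear U"
    by (intro bounded_linear_intro[where K = 1]) (simp_all add: add scale scaleR_scaleC)
  with scale iso U show thesis by (intro that[of U]) (auto simp: bounded_operators_def)
qed


section \<open>A real orthonormal basis\<close>

context conjugation_on
begin

text \<open>The Fourier coefficients are real: applying \<open>C\<close> to both arguments swaps
  them, which amounts to complex conjugation.\<close>

lemma C_transfer_sum_real:
  assumes "\<And>k. k \<in> K \<Longrightarrow> C (e k) = e k" "C x = x"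
  shows "C (transfer_sum e e K x) = transfer_sum e e K x"
proof -
  have "cnj (cinner x (e k)) = cinner x (e k)" if "k \<in> K" for k
    using cinner_C_C[of x "e k"] assms that cinner_commute[of "e k" x] by simp
  then show ?thesis unfolding transfer_sum_def C.sum using assms by (simp add: C_scaleC)
qed

text \<open>One Gram-Schmidt step. The residual \<open>r\<close> is again fixed by \<open>C\<close>,
  and normalising it by a real factor keeps it so. Since the projection of \<open>x\<close> is
  orthogonal to \<open>r\<close>, the coefficient of \<open>x\<close> along \<open>v\<close> is
  \<open>norm r\<close>, which recovers \<open>r\<close>.\<close>

lemma real_residual:
  assumes K: "finite K" "orthonormal_on K e" "\<And>k. k \<in> K \<Longrightarrow> C (e k) = e k"
    and x: "C x = x" "transfer_sum e e K x \<noteq> x"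
  obtains v where "C v = v" "norm v = 1" "\<And>k. k \<in> K \<Longrightarrow> cinner v (e k) = 0"
    "x = transfer_sum e e K x + cinner x v *\<^sub>C v"
proof -
  define r where "r = x - transfer_sum e e K x"
  define v where "v = (1 / norm r) *\<^sub>R r"
  have r: "r \<noteq> 0" "C r = r" using x C_transfer_sum_real[of K e x] K by (auto simp: r_def C.diff)
  have rK: "cinner r (e k) = 0" if "k \<in> K" for k
    unfolding r_def using K that by (intro cinner_residual_basis)
  have "cinner (transfer_sum e e K x) r = 0"
    unfolding transfer_sum_def cinner.sum_left cinner_scaleC_left
    using rK cinner_commute[of _ r] by simp
  then have "cinner x r = cinner r r" by (simp add: r_def cinner.diff_left)
  then have "cinner x v = of_real (norm r)"
    using r by (simp add: v_def cinner_scaleR_right norm_sq_eq_cinner[symmetric] power2_eq_square)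
  then have "cinner x v *\<^sub>C v = r"
    using r by (simp add: v_def scaleR_scaleC[symmetric])
  moreover have "C v = v" "norm v = 1" using r by (simp_all add: v_def C.scaleR)
  moreover have "cinner v (e k) = 0" if "k \<in> K" for k
    using rK[OF that] by (simp add: v_def cinner_scaleR_left)
  ultimately show thesis by (intro that) (auto simp: r_def)
qed

lemma real_not_fixed:
  fixes e :: "'i \<Rightarrow> 'a"
  assumes inf: "infinite_dimensional TYPE('a)" and K: "finite K"
  obtains x where "C x = x" "transfer_sum e e K x \<noteq> x"
proof (rule ccontr)
  assume "\<not> thesis"
  with that have real: "transfer_sum e e K x = x" if "C x = x" for x using that by blast
  interpret vs: vector_space "scaleC :: complex \<Rightarrow> 'a \<Rightarrow> 'a" by (rule vector_space_scaleC)
  have "x \<in> vs.span (e ` K)" for x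
  proof -
    obtain a b where "C a = a" "C b = b" "x = a + \<i> *\<^sub>C b" by (rule real_parts)
    then have "x = transfer_sum e e K x" by (simp add: transfer_sum_add transfer_sum_scaleC real)
    also have "\<dots> \<in> vs.span (e ` K)"
      unfolding transfer_sum_def by (intro vs.span_sum vs.span_scale vs.span_base) auto
    finally show ?thesis .
  qed
  then show False using inf K unfolding infinite_dimensional_def by blast
qed

text \<open>Averaging \<open>d\<close> with \<open>C d\<close> sends a countable dense set into the
  fixed vectors. As \<open>C\<close> is isometric, this does not increase the distance to a fixed
  vector.\<close>

lemma dense_real_sequence:
  assumes "separable_space (euclidean :: 'a topology)"
  obtains r :: "nat \<Rightarrow> 'a" where "\<And>n. C (r n) = r n"
    "\<And>x \<epsilon>. C x = x \<Longrightarrow> \<epsilon> > 0 \<Longrightarrow> \<exists>n. norm (x - r n) < \<epsilon>"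
proof -
  obtain D :: "'a set" where D: "countable D" "closure D = UNIV"
    using assms by (auto simp: separable_space_def)
  then have ne: "D \<noteq> {}" by auto
  define r where "r n = (1/2) *\<^sub>R (from_nat_into D n + C (from_nat_into D n))" for n
  show thesis
  proof
    show "C (r n) = r n" for n by (simp add: r_def C.scaleR C.add C_C add.commute)
    fix x and \<epsilon> :: real
    assume x: "C x = x" and \<epsilon>: "\<epsilon> > 0"
    then obtain d where "d \<in> D" "dist d x < \<epsilon>"
      using D(2) closure_approachable[of x D] by auto
    then obtain n where n: "norm (x - from_nat_into D n) < \<epsilon>"
      using from_nat_into_surj[OF D(1)] by (metis dist_commute dist_norm)
    let ?d = "x - from_nat_into D n"
    have "x - r n = (1/2) *\<^sub>R (?d + C ?d)"
    proof -
      have "x = (1/2) *\<^sub>R (x + C x)" using x by (simp add: scaleR_2[symmetric])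
      then show ?thesis by (simp add: r_def C.diff algebra_simps)
    qed
    then have "norm (x - r n) \<le> norm ?d"
      using norm_triangle_ineq[of ?d "C ?d"] by (simp add: norm_C)
    with n show "\<exists>n. norm (x - r n) < \<epsilon>" by (intro exI[of _ n]) simp
  qed
qed

lemma real_orthonormal_basis:
  assumes sep: "separable_space (euclidean :: 'a topology)"
    and inf: "infinite_dimensional TYPE('a)"
  obtains e :: "nat \<Rightarrow> 'a" where "\<And>n. C (e n) = e n" "orthonormal_on UNIV e"
    "\<And>x. (\<lambda>n. transfer_sum e e {..<n} x) \<longlonglongrightarrow> x"
proof -
  obtain r :: "nat \<Rightarrow> 'a" where r: "\<And>n. C (r n) = r n"
    "\<And>x \<epsilon>. C x = x \<Longrightarrow> \<epsilon> > 0 \<Longrightarrow> \<exists>n. norm (x - r n) < \<epsilon>"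
    using dense_real_sequence[OF sep] by blast
  \<comment> \<open>\<open>v\<close> is an admissible vector number \<open>n\<close> after the
    earlier ones; the last conjunct puts \<open>r n\<close> in the span of \<open>e 0\<close>, ...,
    \<open>e (n - 1)\<close> and \<open>v\<close>.\<close>
  define P where "P e n v \<longleftrightarrow> C v = v \<and> norm v = 1 \<and> (\<forall>k<n. cinner v (e k) = 0) \<and>
    r n = transfer_sum e e {..<n} (r n) + cinner (r n) v *\<^sub>C v" for e n v
  have orth: "orthonormal_on {..<n} e" if "\<And>k. k < n \<Longrightarrow> P e k (e k)" for e n
    unfolding orthonormal_on_def
  proof (intro ballI)
    fix i j assume "i \<in> {..<n}" "j \<in> {..<n}"
    then have "P e i (e i)" "P e j (e j)" using that by auto
    then show "cinner (e i) (e j) = of_bool (i = j)"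
      using cinner_commute[of "e i" "e j"] norm_sq_eq_cinner[of "e i"]
      by (cases i j rule: linorder_cases) (auto simp: P_def)
  qed
  \<comment> \<open>Well-founded choice applies because \<open>P e n v\<close> only looks at the
    values of \<open>e\<close> below \<open>n\<close>.\<close>
  have "\<exists>e. \<forall>n. P e n (e n)"
  proof (rule dependent_wf_choice[OF wf_less_than])
    show "P e n v = P e' n v" if "\<And>k. (k, n) \<in> less_than \<Longrightarrow> e k = e' k" for e e' n v
      using that by (simp add: P_def transfer_sum_def)
  next
    fix n e assume "\<And>k. (k, n) \<in> less_than \<Longrightarrow> P e k (e k)"
    then have prev: "P e k (e k)" if "k < n" for k using that by simp
    then have K: "finite {..<n}" "orthonormal_on {..<n} e" "\<And>k. k \<in> {..<n} \<Longrightarrow> C (e k) = e k"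
      using orth by (auto simp: P_def)
    show "\<exists>v. P e n v"
    proof (cases "transfer_sum e e {..<n} (r n) = r n")
      case False
      obtain v where "C v = v" "norm v = 1" "\<And>k. k \<in> {..<n} \<Longrightarrow> cinner v (e k) = 0"
        "r n = transfer_sum e e {..<n} (r n) + cinner (r n) v *\<^sub>C v"
        using real_residual[OF K r(1) False] by blast
      then have "P e n v" by (simp add: P_def)
      then show ?thesis ..
    \<comment> \<open>Here \<open>r n\<close> already lies in the span of the earlier vectors.
      Infinite dimension supplies some other fixed direction, orthogonal to them, along which
      \<open>r n\<close> has coefficient 0.\<close>
    next
      case True
      obtain x where x: "C x = x" "transfer_sum e e {..<n} x \<noteq> x"
        using real_not_fixed[OF inf K(1)] by blast
      obtain v where v: "C v = v" "norm v = 1" "\<And>k. k \<in> {..<n} \<Longrightarrow> cinner v (e k) = 0"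
        using real_residual[OF K x] by blast
      have "cinner (transfer_sum e e {..<n} (r n)) v = 0"
        unfolding transfer_sum_def cinner.sum_left cinner_scaleC_left
        using v(3) cinner_commute[of _ v] by simp
      then have "P e n v" using True v by (simp add: P_def scaleC.zero_left)
      then show ?thesis ..
    qed
  qed
  then obtain e where e: "\<And>n. P e n (e n)" by blast
  have on: "orthonormal_on {..<n} e" for n by (rule orth) (rule e)
  have "orthonormal_on UNIV e"
    unfolding orthonormal_on_def
  proof (intro ballI)
    fix i j :: nat
    show "cinner (e i) (e j) = of_bool (i = j)"
      using on[of "Suc (max i j)"] by (auto simp: orthonormal_on_def less_Suc_eq_le)
  qed
  moreover have conv: "(\<lambda>n. transfer_sum e e {..<n} x) \<longlonglongrightarrow> x" if x: "C x = x" for x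
  proof (rule metric_LIMSEQ_I)
    fix \<epsilon> :: real assume "\<epsilon> > 0"
    then obtain m where m: "norm (x - r m) < \<epsilon>" using r(2)[OF x] by blast
    \<comment> \<open>The sum over \<open>{..<Suc m}\<close> reproduces \<open>r m\<close>, and
      later coefficients of \<open>r m\<close> vanish. So from \<open>Suc m\<close> on the error for
      \<open>x\<close> is, up to sign, the residual of \<open>x - r m\<close>, no longer than
      \<open>x - r m\<close> itself.\<close>
    have "dist (transfer_sum e e {..<n} x) x < \<epsilon>" if n: "n \<ge> Suc m" for n
    proof -
      have "transfer_sum e e {..<n} (r m)
          = transfer_sum e e {..<Suc m} (r m) + transfer_sum e e {Suc m..<n} (r m)"
        using sum.atLeastLessThan_concat[of 0 "Suc m" n "\<lambda>k. cinner (r m) (e k) *\<^sub>C e k"] n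
        by (simp add: transfer_sum_def lessThan_atLeast0)
      also have fix_m: "transfer_sum e e {..<Suc m} (r m) = r m"
        using e[of m] by (simp add: P_def transfer_sum_def)
      also have "transfer_sum e e {Suc m..<n} (r m) = 0"
        unfolding transfer_sum_def
      proof (intro sum.neutral ballI)
        fix k assume k: "k \<in> {Suc m..<n}"
        have "cinner (transfer_sum e e {..<Suc m} (r m)) (e k) = 0"
          unfolding transfer_sum_def cinner.sum_left cinner_scaleC_left
          using k on[of n] by (intro sum.neutral) (auto simp: orthonormal_on_def)
        then show "cinner (r m) (e k) *\<^sub>C e k = 0" by (simp add: fix_m scaleC.zero_left)
      qed
      finally have "transfer_sum e e {..<n} x - x = - ((x - r m) - transfer_sum e e {..<n} (x - r m))"
        by (simp add: transfer_sum_diff)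
      then have "dist (transfer_sum e e {..<n} x) x \<le> norm (x - r m)"
        unfolding dist_norm using norm_residual_le[OF _ on, of n "x - r m"]
        by (metis finite_lessThan norm_minus_cancel)
      with m show ?thesis by simp
    qed
    then show "\<exists>N. \<forall>n\<ge>N. dist (transfer_sum e e {..<n} x) x < \<epsilon>" by blast
  qed
  have "(\<lambda>n. transfer_sum e e {..<n} x) \<longlonglongrightarrow> x" for x
  proof -
    obtain a b where ab: "C a = a" "C b = b" "x = a + \<i> *\<^sub>C b" by (rule real_parts)
    show ?thesis
      unfolding ab(3) transfer_sum_add transfer_sum_scaleC
      by (intro tendsto_add conv scaleC.tendsto tendsto_const ab)
  qed
  ultimately show thesis using e by (intro that) (auto simp: P_def)
qed

text \<open>The range of \<open>U\<close> is isotropic for the bilinear form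
  \<open>cinner (C x) y\<close>. On the basis this is the cancellation 1 + i * i = 0 for equal
  indices, and disjointness of the pairs \<open>2 * n\<close>, \<open>2 * n + 1\<close> for
  different ones. The factor \<open>1 / sqrt 2\<close> makes \<open>f\<close> orthonormal.\<close>

lemma isotropic_isometry:
  assumes sep: "separable_space (euclidean :: 'a topology)"
    and inf: "infinite_dimensional TYPE('a)"
  obtains U where "U \<in> bounded_operators" "\<And>x y. cinner (U x) (U y) = cinner x y"
    "\<And>x y. cinner (C (U x)) (U y) = 0"
proof -
  obtain e :: "nat \<Rightarrow> 'a" where e: "\<And>n. C (e n) = e n" "orthonormal_on UNIV e"
    "\<And>x. (\<lambda>n. transfer_sum e e {..<n} x) \<longlonglongrightarrow> x"
    using real_orthonormal_basis[OF sep inf] by blast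
  define f where "f n = (1 / sqrt 2) *\<^sub>R (e (2 * n) + \<i> *\<^sub>C e (2 * n + 1))" for n
  have ee: "cinner (e i) (e j) = of_bool (i = j)" for i j
    using e(2) by (simp add: orthonormal_on_def)
  have odd: "2 * i \<noteq> Suc (2 * j)" "Suc (2 * j) \<noteq> 2 * i" for i j :: nat by presburger+
  have two: "complex_of_real (sqrt 2) * complex_of_real (sqrt 2) = 2"
    by (simp flip: of_real_mult)
  note simps = cinner_scaleR_left cinner_scaleR_right cinner_add_left cinner_add_right
    cinner_scaleC_left cinner_scaleC_right ee odd
  have f: "orthonormal_on UNIV f"
    unfolding orthonormal_on_def by (auto simp: f_def simps two)
  have Cf: "cinner (C (f i)) (f j) = 0" for i j
    by (simp add: f_def C.scaleR C.add C_scaleC e(1) simps)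
  obtain U where U: "U \<in> bounded_operators" "\<And>x y. cinner (U x) (U y) = cinner x y"
    "\<And>x. (\<lambda>n. transfer_sum e f {..<n} x) \<longlonglongrightarrow> U x"
    using transfer_isometry[OF e(2) f e(3)] by blast
  \<comment> \<open>Isotropy passes from \<open>f\<close> to finite sums, then to limits by
    continuity of \<open>C\<close> and \<open>cinner\<close>.\<close>
  have "cinner (C (transfer_sum e f {..<n} x)) (transfer_sum e f {..<n} y) = 0" for n x y
    by (simp add: transfer_sum_def C.sum C_scaleC cinner.sum_left cinner.sum_right
        cinner_scaleC_left cinner_scaleC_right Cf)
  then have "cinner (C (U x)) (U y) = 0" for x y
    using cinner.tendsto[OF C.tendsto[OF U(3)] U(3), of x y] by (simp add: LIMSEQ_const_iff)
  with U show thesis by (intro that)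
qed

end


section \<open>The embedding into the skew operators\<close>

text \<open>Leaves only an injective Lie homomorphism into \<open>H\<close> to be constructed: its
  image is the required subalgebra.\<close>

lemma lie_subalgebra_image:
  assumes L: "lie_subalgebra L G" and into: "\<phi> ` L \<subseteq> H" and inj: "inj_on \<phi> L"
    and add: "\<And>X Y. X \<in> L \<Longrightarrow> Y \<in> L \<Longrightarrow> \<phi> (\<lambda>x. X x + Y x) = (\<lambda>x. \<phi> X x + \<phi> Y x)"
    and scale: "\<And>c X. X \<in> L \<Longrightarrow> \<phi> (\<lambda>x. c *\<^sub>C X x) = (\<lambda>x. c *\<^sub>C \<phi> X x)"
    and comm: "\<And>X Y. X \<in> L \<Longrightarrow> Y \<in> L \<Longrightarrow> \<phi> (commutator X Y) = commutator (\<phi> X) (\<phi> Y)"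
  shows "lie_subalgebra (\<phi> ` L) H" "lie_isomorphic L (\<phi> ` L)"
proof -
  have "\<phi> (\<lambda>x. 0) = (\<lambda>x. 0)"
    using scale[of "\<lambda>x. 0" 0] L by (simp add: lie_subalgebra_def scaleC.zero_left)
  then have zero: "(\<lambda>x. 0) \<in> \<phi> ` L" using L by (auto simp: lie_subalgebra_def intro!: rev_image_eqI)
  have "\<phi> (\<lambda>x. X x + Y x) \<in> \<phi> ` L" "\<phi> (\<lambda>x. c *\<^sub>C X x) \<in> \<phi> ` L" "\<phi> (commutator X Y) \<in> \<phi> ` L"
    if "X \<in> L" "Y \<in> L" for c X Y
    using L that by (auto simp: lie_subalgebra_def)
  with zero show "lie_subalgebra (\<phi> ` L) H"
    using into unfolding lie_subalgebra_def by (auto simp flip: add scale comm)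
  show "lie_isomorphic L (\<phi> ` L)"
    unfolding lie_isomorphic_def using inj add scale comm by (auto simp: bij_betw_def)
qed

theorem proposition2p8:
  fixes C :: "'a :: complex_hilbert \<Rightarrow> 'a" and L :: "('a \<Rightarrow> 'a) set"
  assumes "separable_space (euclidean :: 'a topology)"
    and "infinite_dimensional TYPE('a)"
    and "conjugation C"
    and "lie_subalgebra L bounded_operators"
  shows "\<exists>M. lie_subalgebra M (skew_operators C) \<and> lie_isomorphic L M"
proof -
  interpret conjugation_on C by unfold_locales (rule assms(3))
  obtain U where U: "U \<in> bounded_operators" "\<And>x y. cinner (U x) (U y) = cinner x y"
    "\<And>x y. cinner (C (U x)) (U y) = 0"
    using isotropic_isometry[OF assms(1,2)] by blast
  define W where "W = cadjoint U"
  have W: "W \<in> bounded_operators" unfolding W_def by (rule cadjoint_bounded_operators[OF U(1)])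
  \<comment> \<open>This relation and \<open>WCU\<close> express that \<open>U\<close> is isometric
    and isotropic. Injectivity and the bracket identity both rest on them.\<close>
  have WU: "W (U x) = x" for x
    by (rule cinner_eq_rightD) (simp add: W_def cadjoint[OF U(1), symmetric] U(2))
  have WCU: "W (C (U x)) = 0" for x
  proof (rule cinner_eq_rightD)
    show "cinner y (W (C (U x))) = cinner y 0" for y
      using U(3)[of x y] cinner_commute[of "U y" "C (U x)"]
      by (simp add: W_def cadjoint[OF U(1), symmetric] cinner.zero_right)
  qed
  interpret U: bounded_linear U by (rule bounded_operatorsD(1)[OF U(1)])
  interpret W: bounded_linear W by (rule bounded_operatorsD(1)[OF W])
  note UC = bounded_operatorsD(2)[OF U(1)]
  define A where "A X = (\<lambda>x. U (X (W x)))" for X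
  define \<phi> where "\<phi> X = (\<lambda>x. A X x - C (cadjoint (A X) (C x)))" for X
  have A: "A X \<in> bounded_operators" if "X \<in> bounded_operators" for X
    unfolding A_def by (rule bounded_operators_compose[OF U(1) bounded_operators_compose[OF that W]])
  have adjA: "cadjoint (A X) = A (cadjoint X)" if X: "X \<in> bounded_operators" for X
    using cadjoint_compose[OF U(1) bounded_operators_compose[OF X W]] cadjoint_compose[OF X W]
      cadjoint_cadjoint[OF U(1)]
    by (simp add: A_def W_def)
  have \<phi>_eq: "\<phi> X x = U (X (W x)) - C (U (cadjoint X (W (C x))))" if "X \<in> bounded_operators" for X x
    by (simp add: \<phi>_def adjA that) (simp add: A_def)
  \<comment> \<open>With \<open>B = A X\<close>, the adjoint of B - C B* C is B* - C B C, while
    conjugating by \<open>C\<close> gives C B C - B*, its negative.\<close>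
  have skew: "\<phi> X \<in> skew_operators C" if X: "X \<in> bounded_operators" for X
  proof -
    note AX = A[OF X]
    have AX': "cadjoint (A X) \<in> bounded_operators" by (rule cadjoint_bounded_operators[OF AX])
    have "\<phi> X \<in> bounded_operators"
      unfolding \<phi>_def
      by (rule bounded_operators_diff[OF AX conjugate_bounded_operators[OF AX']])
    moreover have "cadjoint (\<phi> X) = (\<lambda>x. cadjoint (A X) x - C (A X (C x)))"
      unfolding \<phi>_def cadjoint_diff[OF AX conjugate_bounded_operators[OF AX']]
        cadjoint_conjugate[OF AX'] cadjoint_cadjoint[OF AX] ..
    ultimately show ?thesis by (simp add: skew_operators_def \<phi>_def fun_eq_iff C.diff C_C)
  qed
  have L: "X \<in> bounded_operators" if "X \<in> L" for X
    using assms(4) that by (auto simp: lie_subalgebra_def)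
  have L_comm: "commutator X Y \<in> L" and L_add: "(\<lambda>x. X x + Y x) \<in> L"
    and L_scale: "(\<lambda>x. c *\<^sub>C X x) \<in> L" if "X \<in> L" "Y \<in> L" for X Y c
    using assms(4) that by (auto simp: lie_subalgebra_def)
  \<comment> \<open>Compression by \<open>W\<close> and \<open>U\<close> kills the second summand by
    \<open>WCU\<close> and undoes the first by \<open>WU\<close>, which gives injectivity.\<close>
  have rec: "W (\<phi> X (U x)) = X x" if X: "X \<in> L" for X x
    using bounded_linear.linear[OF bounded_operatorsD(1)[OF cadjoint_bounded_operators[OF L[OF X]]]]
    by (simp add: \<phi>_eq L X W.diff WU WCU linear_0 U.zero C.zero W.zero)
  have "inj_on \<phi> L"
  proof (rule inj_onI)
    fix X Y assume "X \<in> L" "Y \<in> L" "\<phi> X = \<phi> Y"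
    then show "X = Y" using rec by (metis ext)
  qed
  moreover have "\<phi> ` L \<subseteq> skew_operators C" using skew L by auto
  moreover have "\<phi> (\<lambda>x. X x + Y x) = (\<lambda>x. \<phi> X x + \<phi> Y x)" if "X \<in> L" "Y \<in> L" for X Y
    using L[OF L_add[OF that]] L that
    by (simp add: fun_eq_iff \<phi>_eq cadjoint_add U.add C.add)
  \<comment> \<open>The adjoint conjugates the scalar and \<open>C\<close> conjugates it back, so
    both summands are complex linear in \<open>X\<close>.\<close>
  moreover have "\<phi> (\<lambda>x. c *\<^sub>C X x) = (\<lambda>x. c *\<^sub>C \<phi> X x)" if "X \<in> L" for c X
    using L[OF L_scale[OF that that]] L that
    by (simp add: fun_eq_iff \<phi>_eq cadjoint_scaleC UC C_scaleC scaleC.diff_right)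
  moreover have "\<phi> (commutator X Y) = commutator (\<phi> X) (\<phi> Y)" if XY: "X \<in> L" "Y \<in> L" for X Y
  proof -
    note X = L[OF XY(1)] and Y = L[OF XY(2)]
    have adj: "cadjoint (commutator X Y)
        = (\<lambda>x. cadjoint Y (cadjoint X x) - cadjoint X (cadjoint Y x))"
      unfolding commutator_def
        cadjoint_diff[OF bounded_operators_compose[OF X Y] bounded_operators_compose[OF Y X]]
        cadjoint_compose[OF X Y] cadjoint_compose[OF Y X] ..
    \<comment> \<open>The mixed terms contain W C U and vanish; in the last term two minus signs
      cancel. On antisymmetrising, this plus sign matches the minus sign of \<open>\<phi>\<close>
      together with the order reversal in \<open>adj\<close>.\<close>
    have prod: "\<phi> X (\<phi> Y x) = U (X (Y (W x))) + C (U (cadjoint X (cadjoint Y (W (C x)))))"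
      if "X \<in> L" "Y \<in> L" for X Y x
    proof -
      interpret X: bounded_linear X by (rule bounded_operatorsD(1)[OF L[OF that(1)]])
      interpret X': bounded_linear "cadjoint X"
        by (rule bounded_operatorsD(1)[OF cadjoint_bounded_operators[OF L[OF that(1)]]])
      show ?thesis
        by (simp add: \<phi>_eq L that W.diff C.diff C_C WU WCU X'.neg U.neg C.neg)
    qed
    show ?thesis
      using L[OF L_comm[OF XY]] prod XY
      by (simp add: fun_eq_iff \<phi>_eq adj U.diff C.diff) (simp add: commutator_def prod U.diff)
  qed
  ultimately show ?thesis
    using lie_subalgebra_image[OF assms(4), of \<phi> "skew_operators C"] by blast
qed

end
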